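(* Let $C\subset\mathbb{R}^m$ be a closed convex cone, let $A_1,\dots,A_n,B\in\mathbb{R}^m$ and $c\in\mathbb{R}^n$. Consider the primal program $$(P)\quad \min\Big\{\sum_{i=1}^n c_i x_i:\ \sum_{i=1}^n A_i x_i-B\in C,\ x\in\mathbb{R}^n\Big\}$$ and the dual program $$(D)\quad \max\big\{B\cdot Y:\ A_i\cdot Y=c_i\ \forall i\in\{1,\dots,n\},\ Y\in C^*\big\}.$$ If $(D)$ is bounded and has a strictly feasible solution, then the optimal values of $(P)$ and $(D)$ are equal and $(P)$ reaches this value (there is a feasible $x$ of $(P)$ whose objective value equals the optimal value of $(D)$).
   Context: A convex cone is a (non-empty) set closed under linear combinations with positive coefficients. The dual cone is $C^*=\{Y\in\mathbb{R}^m:\ X\cdot Y\ge 0\ \forall X\in C\}$, where $\cdot$ is the standard scalar product. The optimal value of $(P)$ is the infimum of the objective over feasible points and that of $(D)$ is the supremum (not necessarily attained). "$(D)$ is bounded" means its supremum is not $+\infty$. A strictly feasible solution of $(D)$ is a $Y$ in the (topological) interior of $C^*$ in $\mathbb{R}^m$ with $A_i\cdot Y=c_i$ for all $i$. *)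

theory Defs
  imports "HOL-Analysis.Analysis"
begin

text \<open>
  The library predicate \<^const>\<open>convex_cone\<close> asks for closure under nonnegative scaling, so
  such a cone contains the origin. For closed sets this is the same as being nonempty and closed
  under linear combinations with positive coefficients.
\<close>

lemma closed_convex_cone_iff_positive_combinations:
  fixes C :: "'a::real_normed_vector set"
  assumes "closed C"
  shows "convex_cone C \<longleftrightarrow>
    C \<noteq> {} \<and> (\<forall>x\<in>C. \<forall>y\<in>C. \<forall>a>0. \<forall>b>0. a *\<^sub>R x + b *\<^sub>R y \<in> C)"
proof
  assume "convex_cone C"
  then show "C \<noteq> {} \<and> (\<forall>x\<in>C. \<forall>y\<in>C. \<forall>a>0. \<forall>b>0. a *\<^sub>R x + b *\<^sub>R y \<in> C)"
    by (auto simp: convex_cone_nonempty intro!: convex_cone_add convex_cone_scaleR)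
next
  assume R: "C \<noteq> {} \<and> (\<forall>x\<in>C. \<forall>y\<in>C. \<forall>a>0. \<forall>b>0. a *\<^sub>R x + b *\<^sub>R y \<in> C)"
  have pos: "a *\<^sub>R x \<in> C" if "x \<in> C" "a > 0" for a x
  proof -
    have "(a/2) *\<^sub>R x + (a/2) *\<^sub>R x \<in> C" using R that by simp
    then show ?thesis by (simp flip: scaleR_left_distrib)
  qed
  obtain x0 where x0: "x0 \<in> C" using R by blast
  have "(\<lambda>n. inverse (real (Suc n)) *\<^sub>R x0) \<longlonglongrightarrow> 0 *\<^sub>R x0"
    by (intro tendsto_intros LIMSEQ_inverse_real_of_nat)
  moreover have "inverse (real (Suc n)) *\<^sub>R x0 \<in> C" for n
    by (intro pos x0) simp
  ultimately have zero: "0 \<in> C"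
    using closed_sequentially[OF assms, of "\<lambda>n. inverse (real (Suc n)) *\<^sub>R x0" "0 *\<^sub>R x0"] by simp
  have add: "x + y \<in> C" if "x \<in> C" "y \<in> C" for x y
  proof -
    have "1 *\<^sub>R x + 1 *\<^sub>R y \<in> C" using R that zero_less_one by blast
    then show ?thesis by simp
  qed
  have "a *\<^sub>R x \<in> C" if "x \<in> C" "a \<ge> 0" for a x
    using pos[OF that(1), of a] zero that(2) by (cases "a = 0") auto
  then show "convex_cone C"
    using add zero by (auto simp: convex_cone_iff)
qed

definition dual_cone :: "(real ^ 'm) set \<Rightarrow> (real ^ 'm) set" where
  "dual_cone C = {Y. \<forall>X\<in>C. X \<bullet> Y \<ge> 0}"

definition primal_feasible ::
    "(real ^ 'm) set \<Rightarrow> ('n::finite \<Rightarrow> real ^ 'm) \<Rightarrow> real ^ 'm \<Rightarrow> (real ^ 'n) set" where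
  "primal_feasible C A B = {x. (\<Sum>i\<in>UNIV. x $ i *\<^sub>R A i) - B \<in> C}"

definition primal_objective :: "real ^ 'n \<Rightarrow> real ^ 'n \<Rightarrow> real" where
  "primal_objective c x = (\<Sum>i\<in>UNIV. c $ i * x $ i)"

definition dual_feasible ::
    "(real ^ 'm) set \<Rightarrow> ('n::finite \<Rightarrow> real ^ 'm) \<Rightarrow> real ^ 'n \<Rightarrow> (real ^ 'm) set" where
  "dual_feasible C A c = {Y. (\<forall>i. A i \<bullet> Y = c $ i) \<and> Y \<in> dual_cone C}"

definition dual_strictly_feasible ::
    "(real ^ 'm) set \<Rightarrow> ('n::finite \<Rightarrow> real ^ 'm) \<Rightarrow> real ^ 'n \<Rightarrow> (real ^ 'm) set" where
  "dual_strictly_feasible C A c = {Y. (\<forall>i. A i \<bullet> Y = c $ i) \<and> Y \<in> interior (dual_cone C)}"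

text \<open>
  Optimal values are extended reals: an infeasible primal has value \<open>\<infinity>\<close>, an infeasible dual
  has value \<open>-\<infinity>\<close>, and neither value need be attained.
\<close>

definition primal_value ::
    "(real ^ 'm) set \<Rightarrow> ('n::finite \<Rightarrow> real ^ 'm) \<Rightarrow> real ^ 'm \<Rightarrow> real ^ 'n \<Rightarrow> ereal" where
  "primal_value C A B c = (INF x\<in>primal_feasible C A B. ereal (primal_objective c x))"

definition dual_value ::
    "(real ^ 'm) set \<Rightarrow> ('n::finite \<Rightarrow> real ^ 'm) \<Rightarrow> real ^ 'm \<Rightarrow> real ^ 'n \<Rightarrow> ereal" where
  "dual_value C A B c = (SUP Y\<in>dual_feasible C A c. ereal (B \<bullet> Y))"

definition dual_bounded ::
    "(real ^ 'm) set \<Rightarrow> ('n::finite \<Rightarrow> real ^ 'm) \<Rightarrow> real ^ 'm \<Rightarrow> real ^ 'n \<Rightarrow> bool" where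
  "dual_bounded C A B c \<longleftrightarrow> dual_value C A B c \<noteq> \<infinity>"

end

theory Submission
  imports Defs
begin

text \<open>
  Let \<open>d\<close> be the dual value. In \<open>(Y, t)\<close>-space, the convex set of points with
  \<open>Y\<close> interior to the dual cone and \<open>t < B \<bullet> Y\<close> misses the affine set \<open>A\<^sub>i \<bullet> Y = c\<^sub>i\<close>,
  \<open>t = d\<close>. A separating functional \<open>(w, s)\<close> is constant on the affine set, so \<open>w\<close> is a
  combination of the \<open>A\<^sub>i\<close>; it is not vertical (\<open>s > 0\<close>) because the affine set contains a point
  with \<open>Y\<close> interior to the dual cone. The coefficients of \<open>- w / s\<close> are feasible for the primal by
  the bipolar theorem, and have objective value at most \<open>d\<close>.
\<close>

lemma dual_cone_scaleR: "Y \<in> dual_cone C \<Longrightarrow> 0 \<le> k \<Longrightarrow> k *\<^sub>R Y \<in> dual_cone C"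
  by (auto simp: dual_cone_def)

lemma dual_cone_zero: "0 \<in> dual_cone C"
  by (simp add: dual_cone_def)

lemma convex_dual_cone: "convex (dual_cone C)"
  by (auto simp: dual_cone_def convex_def inner_add_right)

text \<open>A point outside \<open>C\<close> is strictly separated from it by a hyperplane. Because
  \<open>C\<close> is a cone, the separating bound can be pushed to zero, so the normal
  \<open>a\<close> lies in the dual cone while being negative at \<open>X\<close>.\<close>

lemma bipolar:
  fixes C :: "(real ^ 'm) set"
  assumes "closed C" "convex_cone C"
    and X: "\<And>Y. Y \<in> dual_cone C \<Longrightarrow> 0 \<le> X \<bullet> Y"
  shows "X \<in> C"
proof (rule ccontr)
  assume "X \<notin> C"
  moreover have "convex C"
    using assms(2) by (simp add: convex_cone_def)
  ultimately obtain a b where a: "a \<bullet> X < b" and ab: "\<And>x. x \<in> C \<Longrightarrow> b < a \<bullet> x"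
    using separating_hyperplane_closed_point[of C X] assms(1) by blast
  have "0 \<in> C"
    using assms(2) by (simp add: convex_cone_contains_0)
  then have "b < 0"
    using ab by fastforce
  have "0 \<le> x \<bullet> a" if "x \<in> C" for x
  proof (rule ccontr)
    assume neg: "\<not> 0 \<le> x \<bullet> a"
    \<comment> \<open>Positive rescaling brings \<open>x\<close> onto the hyperplane with value
      exactly \<open>b\<close>, which the strict bound \<open>ab\<close> forbids.\<close>
    have "(b / (x \<bullet> a)) *\<^sub>R x \<in> C"
      using assms(2) that neg \<open>b < 0\<close> by (intro convex_cone_scaleR) (auto simp: divide_simps)
    then show False
      using ab neg by (force simp: inner_commute)
  qed
  then have "0 \<le> X \<bullet> a"
    by (intro X) (auto simp: dual_cone_def)
  with a \<open>b < 0\<close> show False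
    by (simp add: inner_commute)
qed

text \<open>The bound passes to the whole dual cone by continuity, since a convex set with nonempty
  interior lies in the closure of that interior. Evaluating at the origin gives the sign of
  \<open>b\<close>; a positive value of \<open>w\<close> could be scaled past
  \<open>b\<close>.\<close>

lemma linear_bound_on_interior_cone:
  fixes w :: "real ^ 'm"
  assumes int: "interior (dual_cone C) \<noteq> {}"
    and bound: "\<And>Y. Y \<in> interior (dual_cone C) \<Longrightarrow> w \<bullet> Y \<le> b"
  shows "0 \<le> b" and "Y \<in> dual_cone C \<Longrightarrow> w \<bullet> Y \<le> 0"
proof -
  have all: "w \<bullet> Y \<le> b" if "Y \<in> dual_cone C" for Y
  proof -
    have "Y \<in> closure (interior (dual_cone C))"
      using convex_closure_interior[OF convex_dual_cone int] that closure_subset by blast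
    then show ?thesis
      by (rule continuous_le_on_closure[rotated])
        (auto intro!: continuous_intros bound)
  qed
  show b: "0 \<le> b"
    using all[OF dual_cone_zero] by simp
  show "w \<bullet> Y \<le> 0" if "Y \<in> dual_cone C"
  proof (rule ccontr)
    assume pos: "\<not> w \<bullet> Y \<le> 0"
    then have "w \<bullet> (((b + 1) / (w \<bullet> Y)) *\<^sub>R Y) \<le> b"
      using b that by (intro all dual_cone_scaleR) auto
    with pos show False
      by simp
  qed
qed

text \<open>A short step from \<open>Y0\<close> in direction \<open>w\<close> stays in the interior
  and would increase a nonzero functional.\<close>

lemma linear_max_at_interior_imp_zero:
  fixes w :: "'a::euclidean_space"
  assumes "Y0 \<in> interior S" and max: "\<And>Y. Y \<in> interior S \<Longrightarrow> w \<bullet> Y \<le> w \<bullet> Y0"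
  shows "w = 0"
proof (rule ccontr)
  assume "w \<noteq> 0"
  obtain e where "e > 0" and e: "cball Y0 e \<subseteq> interior S"
    using assms(1) open_contains_cball[of "interior S"] by auto
  have "Y0 + (e / norm w) *\<^sub>R w \<in> cball Y0 e"
    using \<open>w \<noteq> 0\<close> \<open>e > 0\<close> by (simp add: dist_norm)
  then have "w \<bullet> (Y0 + (e / norm w) *\<^sub>R w) \<le> w \<bullet> Y0"
    using e by (intro max) auto
  then show False
    using \<open>w \<noteq> 0\<close> \<open>e > 0\<close>
    by (simp add: inner_add_right mult_le_0_iff divide_le_0_iff not_less[symmetric])
qed

lemma linear_bounded_below_on_line_imp_zero:
  fixes p q :: real
  assumes "\<And>k. b \<le> p + k * q"
  shows "q = 0"
proof (rule ccontr)
  assume "q \<noteq> 0"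
  \<comment> \<open>This \<open>k\<close> gives the value \<open>b - 1\<close>.\<close>
  with assms[of "(b - p - 1) / q"] show False
    by simp
qed

text \<open>The hypothesis puts \<open>w\<close> in the double orthogonal complement of the span of
  the \<open>A i\<close>, which is the span itself in finite dimension.\<close>

lemma orthogonal_kernel_imp_combination:
  fixes A :: "'n::finite \<Rightarrow> 'a::euclidean_space"
  assumes w: "\<And>Z. (\<And>i. A i \<bullet> Z = 0) \<Longrightarrow> w \<bullet> Z = 0"
  obtains u :: "real ^ 'n" where "w = (\<Sum>i\<in>UNIV. u $ i *\<^sub>R A i)"
proof -
  define f where "f u = (\<Sum>i\<in>UNIV. u $ i *\<^sub>R A i)" for u :: "real ^ 'n"
  have "linear f"
    by (rule linearI) (simp_all add: f_def scaleR_left_distrib sum.distrib scaleR_sum_right)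
  then have sub: "subspace (range f)"
    by (simp add: linear_subspace_image)
  have f_axis: "f (axis i 1) = A i" for i
    by (simp add: f_def axis_def if_distrib[where f = "\<lambda>r. r *\<^sub>R _"] cong: if_cong)
  have "w \<bullet> Z = 0" if "Z \<in> orthogonal_comp (range f)" for Z
  proof (rule w)
    fix i
    have "orthogonal (f (axis i 1)) Z"
      using that by (auto simp: orthogonal_comp_def orthogonal_commute)
    then show "A i \<bullet> Z = 0"
      by (simp add: f_axis orthogonal_def)
  qed
  then have "w \<in> orthogonal_comp (orthogonal_comp (range f))"
    by (auto simp: orthogonal_comp_def orthogonal_def inner_commute)
  then have "w \<in> range f"
    by (simp add: orthogonal_comp_self sub)
  then show thesis
    using that by (auto simp: f_def)
qed

lemma inner_combination:
  assumes "\<And>i. A i \<bullet> Y = c $ i"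
  shows "(\<Sum>i\<in>UNIV. x $ i *\<^sub>R A i) \<bullet> Y = primal_objective c x"
  using assms by (simp add: inner_sum_left primal_objective_def mult.commute)

lemma weak_duality:
  assumes x: "x \<in> primal_feasible C A B" and Y: "Y \<in> dual_feasible C A c"
  shows "B \<bullet> Y \<le> primal_objective c x"
proof -
  have "0 \<le> ((\<Sum>i\<in>UNIV. x $ i *\<^sub>R A i) - B) \<bullet> Y"
    using x Y by (auto simp: primal_feasible_def dual_feasible_def dual_cone_def)
  then show ?thesis
    using Y by (simp add: inner_diff_left inner_combination dual_feasible_def)
qed

lemma dual_value_le_primal_value: "dual_value C A B c \<le> primal_value C A B c"
  unfolding dual_value_def primal_value_def
  by (intro SUP_least INF_greatest) (simp add: weak_duality)

text \<open>Taking any real upper bound \<open>d\<close> of the dual objective keeps the separation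
  argument free of extended reals. Weak duality later turns the inequality into equality.\<close>

lemma primal_attains_dual_bound:
  fixes C :: "(real ^ 'm) set" and A :: "'n::finite \<Rightarrow> real ^ 'm"
  assumes "closed C" "convex_cone C"
    and Y0: "Y0 \<in> dual_strictly_feasible C A c"
    and d: "\<And>Y. Y \<in> dual_feasible C A c \<Longrightarrow> B \<bullet> Y \<le> d"
  obtains x where "x \<in> primal_feasible C A B" "primal_objective c x \<le> d"
proof -
  let ?I = "interior (dual_cone C)"
  have Y0_int: "Y0 \<in> ?I" and Y0_eq: "\<And>i. A i \<bullet> Y0 = c $ i"
    using Y0 by (auto simp: dual_strictly_feasible_def)
  define S where "S = {(Y, t). Y \<in> ?I \<and> t < B \<bullet> Y}"
  define T where "T = {(Y, t). (\<forall>i. A i \<bullet> Y = c $ i) \<and> t = d}"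
  have "convex S"
    unfolding convex_def
  proof clarify
    fix Y t Y' t' and u v :: real
    assume yt: "(Y, t) \<in> S" "(Y', t') \<in> S" and uv: "0 \<le> u" "0 \<le> v" "u + v = 1"
    have "u *\<^sub>R Y + v *\<^sub>R Y' \<in> ?I"
      using yt uv by (intro convexD convex_interior convex_dual_cone) (auto simp: S_def)
    \<comment> \<open>Strictness comes from whichever point has positive weight: the first unless
      \<open>u = 0\<close>, and then \<open>v = 1\<close>.\<close>
    moreover have "u * t + v * t' < u * (B \<bullet> Y) + v * (B \<bullet> Y')"
    proof (cases "u = 0")
      case False
      then have "u * t < u * (B \<bullet> Y)" "v * t' \<le> v * (B \<bullet> Y')"
        using yt uv by (auto simp: S_def intro: mult_left_mono)
      then show ?thesis
        by linarith
    qed (use yt uv in \<open>auto simp: S_def\<close>)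
    ultimately show "u *\<^sub>R (Y, t) + v *\<^sub>R (Y', t') \<in> S"
      by (simp add: S_def inner_add_right)
  qed
  moreover have "convex T"
    by (auto simp: T_def convex_def inner_add_right simp flip: distrib_right)
  moreover have "(Y0, B \<bullet> Y0 - 1) \<in> S" "(Y0, d) \<in> T"
    by (auto simp: S_def T_def Y0_int Y0_eq)
  moreover have "S \<inter> T = {}"
  proof -
    have "B \<bullet> Y \<le> d" if "Y \<in> ?I" "\<forall>i. A i \<bullet> Y = c $ i" for Y
      using that interior_subset by (intro d) (auto simp: dual_feasible_def)
    then show ?thesis
      by (fastforce simp: S_def T_def)
  qed
  ultimately obtain a b where "a \<noteq> 0"
    and aS: "\<And>p. p \<in> S \<Longrightarrow> a \<bullet> p \<le> b" and aT: "\<And>p. p \<in> T \<Longrightarrow> b \<le> a \<bullet> p"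
    using separating_hyperplane_sets[of S T] by blast
  obtain w s where ws: "a = (w, s)"
    by (cases a)
  have S_le: "w \<bullet> Y + s * t \<le> b" if "Y \<in> ?I" "t < B \<bullet> Y" for Y t
    using aS[of "(Y, t)"] that by (simp add: S_def ws)
  have T_ge: "b \<le> w \<bullet> Y + s * d" if "\<And>i. A i \<bullet> Y = c $ i" for Y
    using aT[of "(Y, d)"] that by (simp add: T_def ws)
  \<comment> \<open>Adding multiples of \<open>Z\<close> to \<open>Y0\<close> stays in the affine
    set, where the functional is bounded below.\<close>
  have "w \<bullet> Z = 0" if Z: "\<And>i. A i \<bullet> Z = 0" for Z
  proof (rule linear_bounded_below_on_line_imp_zero)
    show "b \<le> (w \<bullet> Y0 + s * d) + k * (w \<bullet> Z)" for k
      using T_ge[of "Y0 + k *\<^sub>R Z"] by (simp add: inner_add_right Y0_eq Z)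
  qed
  then obtain u where u: "w = (\<Sum>i\<in>UNIV. u $ i *\<^sub>R A i)"
    by (rule orthogonal_kernel_imp_combination)
  have "0 \<le> s"
  proof (rule ccontr)
    assume "\<not> 0 \<le> s"
    \<comment> \<open>For negative \<open>s\<close>, going down far enough below
      \<open>B \<bullet> Y0\<close> stays in \<open>S\<close> but lifts the functional to at least
      \<open>b + 1\<close>.\<close>
    define t where "t = min (B \<bullet> Y0 - 1) ((b + 1 - w \<bullet> Y0) / s)"
    have "s * ((b + 1 - w \<bullet> Y0) / s) \<le> s * t"
      using \<open>\<not> 0 \<le> s\<close> by (intro mult_left_mono_neg) (auto simp: t_def)
    then have "b + 1 \<le> w \<bullet> Y0 + s * t"
      using \<open>\<not> 0 \<le> s\<close> by simp
    moreover have "w \<bullet> Y0 + s * t \<le> b"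
      by (rule S_le[OF Y0_int]) (simp add: t_def)
    ultimately show False
      by simp
  qed
  moreover have "s \<noteq> 0"
  proof
    assume "s = 0"
    have "w = 0"
    proof (rule linear_max_at_interior_imp_zero[OF Y0_int])
      fix Y assume "Y \<in> ?I"
      then have "w \<bullet> Y \<le> b"
        using S_le[of Y "B \<bullet> Y - 1"] \<open>s = 0\<close> by simp
      also have "b \<le> w \<bullet> Y0"
        using T_ge[OF Y0_eq] \<open>s = 0\<close> by simp
      finally show "w \<bullet> Y \<le> w \<bullet> Y0" .
    qed
    with \<open>a \<noteq> 0\<close> \<open>s = 0\<close> show False
      by (simp add: ws zero_prod_def)
  qed
  ultimately have "0 < s"
    by simp
  \<comment> \<open>Letting \<open>t\<close> approach the excluded boundary
    \<open>B \<bullet> Y\<close> from below: a gap of \<open>e / s\<close> costs exactly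
    \<open>e\<close>.\<close>
  have lim: "(w + s *\<^sub>R B) \<bullet> Y \<le> b" if "Y \<in> ?I" for Y
  proof (rule field_le_epsilon)
    fix e :: real assume "0 < e"
    then have "w \<bullet> Y + s * (B \<bullet> Y - e / s) \<le> b"
      using \<open>0 < s\<close> by (intro S_le[OF that]) simp
    then show "(w + s *\<^sub>R B) \<bullet> Y \<le> b + e"
      using \<open>0 < s\<close> by (simp add: inner_add_left right_diff_distrib)
  qed
  have "?I \<noteq> {}"
    using Y0_int by blast
  note cone = linear_bound_on_interior_cone[OF this lim]
  define x where "x = (- 1 / s) *\<^sub>R u"
  have x: "(\<Sum>i\<in>UNIV. x $ i *\<^sub>R A i) = (- 1 / s) *\<^sub>R w"
    by (simp add: u x_def scaleR_sum_right sum_negf)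
  show thesis
  proof
    have "(\<Sum>i\<in>UNIV. x $ i *\<^sub>R A i) - B \<in> C"
    proof (rule bipolar[OF assms(1,2)])
      fix Y assume "Y \<in> dual_cone C"
      then have "w \<bullet> Y + s * (B \<bullet> Y) \<le> 0"
        using cone(2)[of Y] by (simp add: inner_add_left)
      then show "0 \<le> ((\<Sum>i\<in>UNIV. x $ i *\<^sub>R A i) - B) \<bullet> Y"
        using \<open>0 < s\<close> unfolding x by (simp add: inner_diff_left field_simps)
    qed
    then show "x \<in> primal_feasible C A B"
      by (simp add: primal_feasible_def)
    \<comment> \<open>\<open>Y0\<close> satisfies the dual equations, so \<open>T_ge\<close>
      applies; with \<open>b\<close> nonnegative it bounds the objective of \<open>x\<close>, which
      is the inner product of \<open>- w / s\<close> with \<open>Y0\<close>.\<close>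
    have "0 \<le> w \<bullet> Y0 + s * d"
      using cone(1) T_ge[OF Y0_eq] by simp
    then have "(- 1 / s) *\<^sub>R w \<bullet> Y0 \<le> d"
      using \<open>0 < s\<close> by (simp add: field_simps)
    then show "primal_objective c x \<le> d"
      using inner_combination[where x = x, OF Y0_eq] by (simp only: x)
  qed
qed

theorem theorem7:
  fixes C :: "(real ^ 'm) set"
    and A :: "'n::finite \<Rightarrow> real ^ 'm"
    and B :: "real ^ 'm"
    and c :: "real ^ 'n"
  assumes "closed C" and "convex_cone C"
    and "dual_bounded C A B c"
    and "dual_strictly_feasible C A c \<noteq> {}"
  shows "primal_value C A B c = dual_value C A B c \<and>
    (\<exists>x\<in>primal_feasible C A B. ereal (primal_objective c x) = primal_value C A B c)"
proof -
  obtain Y0 where Y0: "Y0 \<in> dual_strictly_feasible C A c"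
    using assms(4) by blast
  have upper: "ereal (B \<bullet> Y) \<le> dual_value C A B c" if "Y \<in> dual_feasible C A c" for Y
    unfolding dual_value_def using that by (rule SUP_upper)
  have "Y0 \<in> dual_feasible C A c"
    using Y0 interior_subset by (auto simp: dual_strictly_feasible_def dual_feasible_def)
  \<comment> \<open>Feasibility excludes the value of an empty supremum and boundedness excludes the
    other infinity, so the dual value is a real \<open>d\<close>.\<close>
  then have "dual_value C A B c \<noteq> - \<infinity>"
    using upper by fastforce
  then obtain d where d: "dual_value C A B c = ereal d"
    using assms(3) by (cases "dual_value C A B c") (auto simp: dual_bounded_def)
  then have "B \<bullet> Y \<le> d" if "Y \<in> dual_feasible C A c" for Y
    using upper[OF that] by simp
  then obtain x where x: "x \<in> primal_feasible C A B" "primal_objective c x \<le> d"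
    using primal_attains_dual_bound[OF assms(1,2) Y0] by blast
  have "primal_value C A B c \<le> ereal (primal_objective c x)"
    unfolding primal_value_def using x(1) by (rule INF_lower)
  moreover have "ereal (primal_objective c x) \<le> dual_value C A B c"
    using x(2) d by simp
  ultimately show ?thesis
    using dual_value_le_primal_value[of C A B c] x(1) by (metis order.antisym order.trans)
qed

end
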